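(* For every real number $a$ such that $a>1$ and every positive real number $\lambda$, the function $f:\mathbb{R}_+\to\mathbb{R}$ defined by $f(x)=a^{\lambda x}-1$ belongs to the class $\mathcal{F}$.
   Context: $\mathbb{N}=\{0,1,2,\dots\}$ and $\mathbb{R}_+=[0,\infty)$. The class $\mathcal{F}$ consists of all real-valued functions $f$ whose domain contains $\mathbb{N}$ and such that $f(0)=0$, $f(k+2)-f(k+1)>f(k+1)-f(k)$ for all $k\in\mathbb{N}$, and $(k-2)f(k)\ge k\,(f(k-1)-f(1))$ for all integers $k\ge 3$. *)

theory Defs
  imports Complex_Main
begin

text \<open>
  A real-valued function with domain \<open>D\<close> is represented by a total function that is only
  consulted on \<open>D\<close>. The domain may lie in any type into which \<open>of_nat\<close> embeds the natural
  numbers, so that \<open>\<nat> \<subseteq> D\<close> makes sense. The subtraction \<open>k - 1\<close> on \<open>nat\<close> below is harmless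
  because \<open>k \<ge> 3\<close>.
\<close>

definition class_F :: "'a::semiring_char_0 set \<Rightarrow> ('a \<Rightarrow> real) set" where
  "class_F D = {f. \<nat> \<subseteq> D \<and>
     f 0 = 0 \<and>
     (\<forall>k::nat. f (of_nat (k + 2)) - f (of_nat (k + 1)) > f (of_nat (k + 1)) - f (of_nat k)) \<and>
     (\<forall>k::nat. k \<ge> 3 \<longrightarrow>
        (real k - 2) * f (of_nat k) \<ge> real k * (f (of_nat (k - 1)) - f 1))}"

end

theory Submission
  imports Defs
begin

text \<open>
  With \<open>b = a powr lam > 1\<close> we have \<open>f k = b ^ k - 1\<close>, and the last condition of the class for
  \<open>k = n + 2\<close> says that \<open>g n = n (b ^ (n + 2) - 1) - (n + 2) (b ^ (n + 1) - b)\<close> is nonnegative.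
  Here \<open>g 0 = 0\<close> and \<open>g (n + 1) - b g n = (b - 1) (b ^ (n + 2) - (1 + (n + 2) (b - 1)))\<close>, which is
  nonnegative by Bernoulli's inequality.
\<close>

lemma power_diff_inequality:
  fixes b :: real
  assumes "b \<ge> 1"
  shows "real (n + 2) * (b ^ (n + 1) - b) \<le> real n * (b ^ (n + 2) - 1)"
proof (induction n)
  case 0
  show ?case by simp
next
  case (Suc n)
  define g where "g m = real m * (b ^ (m + 2) - 1) - real (m + 2) * (b ^ (m + 1) - b)" for m
  have "1 + real (n + 2) * (b - 1) \<le> b ^ (n + 2)"
    using Bernoulli_inequality[of "b - 1" "n + 2"] assms by simp
  then have "0 \<le> (b - 1) * (b ^ (n + 2) - (1 + real (n + 2) * (b - 1)))"
    using assms by simp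
  also have "\<dots> = g (Suc n) - b * g n"
    unfolding g_def by (simp add: algebra_simps)
  finally have "b * g n \<le> g (Suc n)" by simp
  \<comment> \<open>The induction hypothesis is \<open>0 \<le> g n\<close>, and multiplying by
    \<open>b \<ge> 1\<close> keeps the sign.\<close>
  moreover have "0 \<le> b * g n"
    using Suc.IH assms by (simp add: g_def)
  ultimately show ?case by (simp add: g_def)
qed

theorem theorem7:
  fixes a lam :: real and f :: "real \<Rightarrow> real"
  assumes "a > 1"
    and "lam > 0"
    and "\<And>x. x \<in> {0..} \<Longrightarrow> f x = a powr (lam * x) - 1"
  shows "f \<in> class_F {0..}"
proof -
  define b where "b = a powr lam"
  have b: "b > 1"
    using assms(1,2) by (simp add: b_def)
  have f: "f (real k) = b ^ k - 1" for k
    using assms(1,3) b by (simp add: b_def powr_powr flip: powr_realpow)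
  have f1: "f 1 = b - 1"
    using f[of 1] by simp
  have convex: "f (real (k + 1)) - f (real k) < f (real (k + 2)) - f (real (k + 1))" for k
  proof -
    \<comment> \<open>This product is exactly the second difference of
      \<open>b ^ k - 1\<close>.\<close>
    have "0 < b ^ k * (b - 1)\<^sup>2"
      using b by simp
    then show ?thesis
      unfolding f by (simp add: power2_eq_square algebra_simps)
  qed
  have ineq: "real k * (f (real (k - 1)) - f 1) \<le> (real k - 2) * f (real k)" if "k \<ge> 3" for k
  proof -
    \<comment> \<open>The shift turns the factor \<open>real k - 2\<close> into
      \<open>real n\<close> and the truncated \<open>k - 1\<close> into \<open>n + 1\<close>; the
      constants cancel in \<open>f (real (k - 1)) - f 1\<close>, leaving
      \<open>b ^ (n + 1) - b\<close>.\<close>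
    from that obtain n where k: "k = n + 2"
      using le_Suc_ex[of 2 k] by auto
    show ?thesis
      using power_diff_inequality[of b n] b unfolding f f1 k by simp
  qed
  show ?thesis
    unfolding class_F_def using f[of 0] convex ineq by (auto simp: Nats_def)
qed

end
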